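(* Let $H:(0,\infty)\to[0,\infty)$ be measurable with $\phi(p)=\int_0^\infty z^{-1/p}H(z)\,dz<\infty$ for all $p\in(1,\infty)$, and suppose that $H$ satisfies at least one of the following two groups of conditions. (a) There is $\delta_0>0$ with $\int_1^\infty z^{-1+\delta_0}H(z)\,dz<\infty$, and there are constants $H_-\in(0,\infty)$, $\beta_1\ge0$, $\gamma>0$ and a non-negative continuous function $S_1$, slowly varying at infinity, such that as $z\to0+$ $$H(z)=H_-\,|\log z|^{\beta_1}S_1(|\log z|)\,\bigl(1+O(|\log z|^{-\gamma})\bigr).$$ (b) There is $\delta_0>0$ with $\int_0^1 z^{-\delta_0}H(z)\,dz<\infty$, and there are constants $H_+\in(0,\infty)$, $\beta_2\ge0$, $\gamma>0$ and a non-negative continuous function $S_2$, slowly varying at infinity, such that as $z\to\infty$ $$H(z)=H_+\,z^{-1}|\log z|^{\beta_2}S_2(|\log z|)\,\bigl(1+O(|\log z|^{-\gamma})\bigr).$$ Let $T_Hf(x)=\int_0^\infty x^{-1}H(y/x)f(y)\,dy$, $x>0$, and for $\psi\in\Psi(1,\infty)$ let $\psi_{(\phi)}(p)=\phi(p)\psi(p)$. Then for all $\psi\in\Psi(1,\infty)$ and $f\in G(\psi)$ $$\|T_Hf\|G(\psi_{(\phi)})\le V_H\,\|f\|G(\psi),$$ where the exact (smallest possible) value of the constant $V_H$ is $1$; that is, $$\sup_{\psi\in\Psi(1,\infty)}\ \sup_{f\in G(\psi),\,f\neq0}\frac{\|T_Hf\|G(\psi_{(\phi)})}{\|f\|G(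\psi)}=1.$$
   Context: Functions are on $(0,\infty)$ with Lebesgue measure, and $|f|_p=(\int_0^\infty|f(x)|^p\,dx)^{1/p}$. $\Psi(1,\infty)$ is the set of continuous positive functions $\psi$ on $(1,\infty)$ such that the limits $\psi(1+0)$ and $\psi(\infty-0)$ exist (finite or infinite), $\inf_{p\in(1,\infty)}\psi(p)>0$, and both limits are positive. $G(\psi)$ is the space of measurable $f$ with $\|f\|G(\psi)=\sup_{p\in(1,\infty)}|f|_p/\psi(p)<\infty$. A function $S$ is slowly varying at infinity if $\lim_{z\to\infty}S(lz)/S(z)=1$ for every $l>0$. *)

theory Defs
  imports "HOL-Analysis.Analysis" "HOL-Library.Landau_Symbols"
begin

abbreviation pos_leb :: "real measure"
  where "pos_leb \<equiv> lebesgue_on {0<..}"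

text \<open>Norms take values in \<^typ>\<open>ennreal\<close>, so that they are defined (possibly infinite) for
  every measurable function. Since there is no real power on \<^typ>\<open>ennreal\<close>, the outer
  exponent \<open>1/p\<close> is taken on reals, with infinity treated separately.\<close>

definition Lp_norm :: "real \<Rightarrow> (real \<Rightarrow> real) \<Rightarrow> ennreal"
  where "Lp_norm p f =
    (let I = (\<integral>\<^sup>+ x. ennreal (\<bar>f x\<bar> powr p) \<partial>pos_leb)
     in if I = \<infinity> then \<infinity> else ennreal (enn2real I powr (1 / p)))"

text \<open>The values of \<open>\<psi>\<close> outside \<open>(1, \<infinity>)\<close> are irrelevant. The one-sided limits may be
  infinite, hence are taken in \<^typ>\<open>ereal\<close>.\<close>

definition Psi_class :: "(real \<Rightarrow> real) set"
  where "Psi_class = {\<psi>.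
    continuous_on {1<..} \<psi> \<and> (\<forall>p>1. \<psi> p > 0) \<and>
    (INF p\<in>{1<..}. \<psi> p) > 0 \<and>
    (\<exists>L>0. ((\<lambda>p. ereal (\<psi> p)) \<longlongrightarrow> L) (at_right 1)) \<and>
    (\<exists>L>0. ((\<lambda>p. ereal (\<psi> p)) \<longlongrightarrow> L) at_top)}"

definition G_norm :: "(real \<Rightarrow> real) \<Rightarrow> (real \<Rightarrow> real) \<Rightarrow> ennreal"
  where "G_norm \<psi> f = (SUP p\<in>{1<..}. Lp_norm p f / ennreal (\<psi> p))"

definition G_space :: "(real \<Rightarrow> real) \<Rightarrow> (real \<Rightarrow> real) set"
  where "G_space \<psi> = {f \<in> borel_measurable pos_leb. G_norm \<psi> f < \<infinity>}"

definition slowly_varying :: "(real \<Rightarrow> real) \<Rightarrow> bool"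
  where "slowly_varying S \<longleftrightarrow> (\<forall>l>0. ((\<lambda>z. S (l * z) / S z) \<longlongrightarrow> 1) at_top)"

definition kernel_phi :: "(real \<Rightarrow> real) \<Rightarrow> real \<Rightarrow> real"
  where "kernel_phi H p = (\<integral>z. z powr (- 1 / p) * H z \<partial>pos_leb)"

definition kernel_op :: "(real \<Rightarrow> real) \<Rightarrow> (real \<Rightarrow> real) \<Rightarrow> real \<Rightarrow> real"
  where "kernel_op H f x = (\<integral>y. 1 / x * H (y / x) * f y \<partial>pos_leb)"

definition cond_at_zero :: "(real \<Rightarrow> real) \<Rightarrow> bool"
  where "cond_at_zero H \<longleftrightarrow>
    (\<exists>\<delta>>0. integrable (lebesgue_on {1..}) (\<lambda>z. z powr (- 1 + \<delta>) * H z)) \<and>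
    (\<exists>Hm>0. \<exists>\<beta>\<ge>0. \<exists>\<gamma>>0. \<exists>S.
       continuous_on {0<..} S \<and> (\<forall>t>0. S t \<ge> 0) \<and> slowly_varying S \<and>
       (\<exists>r \<in> O[at_right 0](\<lambda>z. \<bar>ln z\<bar> powr (- \<gamma>)).
          \<forall>\<^sub>F z in at_right 0. H z = Hm * \<bar>ln z\<bar> powr \<beta> * S \<bar>ln z\<bar> * (1 + r z)))"

definition cond_at_infinity :: "(real \<Rightarrow> real) \<Rightarrow> bool"
  where "cond_at_infinity H \<longleftrightarrow>
    (\<exists>\<delta>>0. integrable (lebesgue_on {0<..1}) (\<lambda>z. z powr (- \<delta>) * H z)) \<and>
    (\<exists>Hp>0. \<exists>\<beta>\<ge>0. \<exists>\<gamma>>0. \<exists>S.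
       continuous_on {0<..} S \<and> (\<forall>t>0. S t \<ge> 0) \<and> slowly_varying S \<and>
       (\<exists>r \<in> O[at_top](\<lambda>z. \<bar>ln z\<bar> powr (- \<gamma>)).
          \<forall>\<^sub>F z in at_top. H z = Hp * (1 / z) * \<bar>ln z\<bar> powr \<beta> * S \<bar>ln z\<bar> * (1 + r z)))"

end

(*
For x > 0 the substitution y = x z gives T_H f(x) = int H(z) f(x z) dz, an average of dilations of f.
Jensen's inequality for the measure z^(-1/p) H(z) dz, of total mass phi(p), followed by Tonelli gives
|T_H f|_p <= phi(p) |f|_p for every p, hence the bound with constant 1.

For sharpness only p = 2 is needed. The function f = x^(-1/2) on [e^(-n), e^n] satisfies
|f|_p <= psi(p) := (2n)^(1/p) e^(n |1/2 - 1/p|), with equality at p = 2, and psi lies in Psi(1, infinity).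
On the slightly smaller window [e^(k-n), e^(n-k)] the function T_H f is at least x^(-1/2) times the
part of phi(2) carried by [e^(-k), e^k]; letting n and then k grow, the ratio of the norms at p = 2
tends to 1. The asymptotics of H serve only to guarantee phi(p) > 0.
*)
theory Submission
  imports Defs
begin

section \<open>Reduction from Lebesgue functions on the half-line to Borel functions on the
  line\<close>

lemma nn_integral_pos_leb:
  "(\<integral>\<^sup>+x. F x \<partial>pos_leb) = (\<integral>\<^sup>+x. F x * indicator {0<..} x \<partial>lborel)"
  by (subst nn_integral_restrict_space) (simp_all add: nn_integral_completion)

lemma AE_pos_leb_iff: "(AE x in pos_leb. P x) \<longleftrightarrow> (AE x in lborel. x > 0 \<longrightarrow> P x)"
  by (subst AE_restrict_space_iff) (simp_all add: AE_completion_iff)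

text \<open>Tonelli and affine substitution are applied to Borel functions over
  \<open>lborel\<close>, while the data are only Lebesgue measurable. Extending the representative
  by 0 turns half-line integrals into whole-line ones.\<close>

lemma pos_leb_borel_representative:
  fixes f :: "real \<Rightarrow> real"
  assumes "f \<in> borel_measurable pos_leb"
  obtains g where "g \<in> borel_measurable borel" "\<forall>x\<le>0. g x = 0" "AE x in pos_leb. f x = g x"
proof -
  have "(\<lambda>x. indicator {0<..} x *\<^sub>R f x) \<in> borel_measurable lebesgue"
    using assms by (subst (asm) borel_measurable_restrict_space_iff) auto
  then obtain g where g: "g \<in> borel_measurable lborel" "AE x in lborel. indicator {0<..} x *\<^sub>R f x = g x"
    using completion_ex_borel_measurable_real by blast
  show thesis
  proof (rule that[of "\<lambda>x. indicator {0<..} x * g x"])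
    show "AE x in pos_leb. f x = indicator {0<..} x * g x"
      unfolding AE_pos_leb_iff using g(2) by eventually_elim auto
  qed (use g in auto)
qed

text \<open>Lebesgue measure is complete, so changing a function on a null set keeps it
  measurable.\<close>

lemma borel_measurable_pos_leb_AE:
  fixes f g :: "real \<Rightarrow> real"
  assumes "f \<in> borel_measurable pos_leb" "AE x in pos_leb. f x = g x"
  shows "g \<in> borel_measurable pos_leb"
proof -
  have "(\<lambda>x. indicator {0<..} x *\<^sub>R f x) \<in> borel_measurable lebesgue"
    using assms(1) by (subst (asm) borel_measurable_restrict_space_iff) auto
  moreover have "AE x in lebesgue. indicator {0<..} x *\<^sub>R f x = indicator {0<..} x *\<^sub>R g x"
    using assms(2) unfolding AE_pos_leb_iff AE_completion_iff by eventually_elim (auto simp: indicator_def)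
  ultimately have "(\<lambda>x. indicator {0<..} x *\<^sub>R g x) \<in> borel_measurable lebesgue"
    by (rule borel_measurable_AE)
  then show ?thesis
    by (subst borel_measurable_restrict_space_iff) auto
qed

lemma borel_imp_measurable_pos_leb:
  "g \<in> borel_measurable borel \<Longrightarrow> g \<in> borel_measurable pos_leb"
  by (intro measurable_restrict_space1 measurable_completion) simp

lemma
  fixes f g :: "real \<Rightarrow> real"
  assumes [measurable]: "g \<in> borel_measurable borel"
    and g0: "\<forall>x\<le>0. g x = 0" and eq: "AE x in pos_leb. f x = g x"
  shows integrable_pos_leb_iff: "integrable pos_leb f \<longleftrightarrow> integrable lborel g"
    and integral_pos_leb: "(\<integral>x. f x \<partial>pos_leb) = (\<integral>x. g x \<partial>lborel)"
proof -
  have gm: "g \<in> borel_measurable pos_leb" by (rule borel_imp_measurable_pos_leb) simp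
  have fm: "f \<in> borel_measurable pos_leb"
    by (rule borel_measurable_pos_leb_AE[OF gm]) (use eq in \<open>auto elim: eventually_mono\<close>)
  have ind: "(\<lambda>x. indicat_real {0<..} x * g x) = g"
    using g0 by (fastforce simp: indicator_def)
  show "integrable pos_leb f \<longleftrightarrow> integrable lborel g"
    unfolding integrable_cong_AE[OF fm gm eq]
    by (subst integrable_restrict_space) (simp_all add: ind integrable_completion)
  show "(\<integral>x. f x \<partial>pos_leb) = (\<integral>x. g x \<partial>lborel)"
    unfolding integral_cong_AE[OF fm gm eq]
    by (subst integral_restrict_space) (simp_all add: ind integral_completion)
qed

text \<open>Dilations preserve null sets. This lets \<open>H\<close> be replaced by its
  representative at the argument \<open>y / x\<close> for each fixed \<open>x\<close>.\<close>

lemma AE_pos_leb_scale: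
  fixes c :: real
  assumes c: "c > 0" and P: "AE x in pos_leb. P x"
  shows "AE x in pos_leb. P (c * x)"
proof -
  have "AE x in lborel. x > 0 \<longrightarrow> P x" using P by (simp add: AE_pos_leb_iff)
  then obtain N where N: "N \<in> null_sets lborel" "{x. \<not> (x > 0 \<longrightarrow> P x)} \<subseteq> N"
    unfolding eventually_ae_filter by auto
  have [measurable]: "N \<in> sets borel" using N(1) by (auto simp: null_sets_def)
  have "AE x in lborel. 0 + c * x \<notin> N"
    by (rule AE_borel_affine) (use c AE_not_in[OF N(1)] in auto)
  then show ?thesis
    unfolding AE_pos_leb_iff by eventually_elim (use N(2) mult_pos_pos[OF c] in auto)
qed

text \<open>The substitution \<open>y = x * z\<close>. It holds for every \<open>x > 0\<close>,
  since for fixed \<open>x\<close> both replacements by representatives fail only on a null set of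
  \<open>y\<close>. Integrability is tracked separately because the Bochner integral of a
  non-integrable function is 0 by default.\<close>

lemma
  fixes H h f g :: "real \<Rightarrow> real"
  assumes [measurable]: "h \<in> borel_measurable borel" "g \<in> borel_measurable borel"
    and h0: "\<forall>x\<le>0. h x = 0" and g0: "\<forall>x\<le>0. g x = 0"
    and H: "AE x in pos_leb. H x = h x" and f: "AE x in pos_leb. f x = g x" and x: "x > 0"
  shows kernel_integrable_iff:
      "integrable pos_leb (\<lambda>y. 1 / x * H (y / x) * f y) \<longleftrightarrow> integrable lborel (\<lambda>z. h z * g (x * z))"
    and kernel_op_eq: "kernel_op H f x = (\<integral>z. h z * g (x * z) \<partial>lborel)"
proof -
  have "AE y in pos_leb. H (1 / x * y) = h (1 / x * y)"
    by (rule AE_pos_leb_scale[OF _ H]) (use x in simp)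
  with f have eq: "AE y in pos_leb. 1 / x * H (y / x) * f y = 1 / x * h (y / x) * g y"
    by eventually_elim simp
  have int: "integrable pos_leb (\<lambda>y. 1 / x * H (y / x) * f y) \<longleftrightarrow> integrable lborel (\<lambda>y. 1 / x * h (y / x) * g y)"
    by (rule integrable_pos_leb_iff[OF _ _ eq]) (auto simp: g0)
  also have "\<dots> \<longleftrightarrow> integrable lborel (\<lambda>z. 1 / x * h ((0 + x * z) / x) * g (0 + x * z))"
    using x by (subst lborel_integrable_real_affine_iff) auto
  also have "\<dots> \<longleftrightarrow> integrable lborel (\<lambda>z. (1 / x) * (h z * g (x * z)))"
    using x by (simp add: mult.assoc)
  also have "\<dots> \<longleftrightarrow> integrable lborel (\<lambda>z. h z * g (x * z))"
    using x by (subst integrable_mult_left_iff) simp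
  finally show "integrable pos_leb (\<lambda>y. 1 / x * H (y / x) * f y) \<longleftrightarrow> integrable lborel (\<lambda>z. h z * g (x * z))" .
  have "kernel_op H f x = (\<integral>y. 1 / x * h (y / x) * g y \<partial>lborel)"
    unfolding kernel_op_def by (rule integral_pos_leb[OF _ _ eq]) (auto simp: g0)
  also have "\<dots> = \<bar>x\<bar> *\<^sub>R (\<integral>z. 1 / x * h ((0 + x * z) / x) * g (0 + x * z) \<partial>lborel)"
    using x by (subst lborel_integral_real_affine[where c=x and t=0]) auto
  also have "\<dots> = x * (\<integral>z. (1 / x) * (h z * g (x * z)) \<partial>lborel)"
    using x by (simp add: mult.assoc)
  also have "\<dots> = (\<integral>z. h z * g (x * z) \<partial>lborel)"
    using x by (simp only: integral_mult_right_zero) simp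
  finally show "kernel_op H f x = (\<integral>z. h z * g (x * z) \<partial>lborel)" .
qed

section \<open>Jensen's inequality and the bound for averages of dilations\<close>

text \<open>Jensen for \<open>t powr p\<close> and a weight of total mass \<phi>, by integrating
  tangent lines and then choosing the best one. The real witness \<open>j\<close> also records that
  the integral is finite.\<close>

lemma weighted_Jensen_powr:
  fixes w u :: "'a \<Rightarrow> real"
  assumes [measurable]: "w \<in> borel_measurable M" "u \<in> borel_measurable M"
    and nonneg: "\<And>x. w x \<ge> 0" "\<And>x. u x \<ge> 0" and p: "p > 1" and \<phi>: "\<phi> > 0" and I: "I \<ge> 0"
    and w: "(\<integral>\<^sup>+x. w x \<partial>M) = ennreal \<phi>"
    and wu: "(\<integral>\<^sup>+x. w x * u x powr p \<partial>M) = ennreal I"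
  obtains j where "j \<ge> 0" "(\<integral>\<^sup>+x. w x * u x \<partial>M) = ennreal j" "j powr p \<le> \<phi> powr (p - 1) * I"
proof -
  have bound: "(\<integral>\<^sup>+x. w x * u x \<partial>M) \<le> ennreal (t powr (1 - p) / p * I + t * (1 - 1 / p) * \<phi>)"
    if t: "t > 0" for t
  proof -
    \<comment> \<open>The tangent line to the \<open>p\<close>-th power at \<open>t\<close>, solved
      for \<open>u x\<close>. It comes from Young's inequality for \<open>u x\<close> and
      \<open>t powr (p - 1)\<close>, with \<open>q\<close> the conjugate exponent of
      \<open>p\<close>.\<close>
    have young: "u x \<le> t powr (1 - p) / p * u x powr p + t * (1 - 1 / p)" for x
    proof -
      define q where "q = p / (p - 1)"
      have q: "q > 1" "1 / p + 1 / q = 1" using p by (auto simp: q_def field_simps)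
      have "u x * t powr (p - 1) \<le> u x powr p / p + (t powr (p - 1)) powr q / q"
        by (rule Youngs_inequality) (use p q nonneg in auto)
      also have "(t powr (p - 1)) powr q = t powr p" using p by (simp add: powr_powr q_def)
      finally have "t powr (1 - p) * (u x * t powr (p - 1)) \<le> t powr (1 - p) * (u x powr p / p + t powr p / q)"
        by (intro mult_left_mono) auto
      moreover have "t powr (1 - p) * t powr (p - 1) = 1" "t powr (1 - p) * t powr p = t"
        using t by (simp_all flip: powr_add)
      moreover have "t powr p / q = t powr p * (1 - 1 / p)" using q by (simp add: divide_inverse eq_diff_eq add.commute)
      moreover have "t powr (1 - p) * (u x powr p / p + t powr p * (1 - 1 / p))
          = t powr (1 - p) / p * u x powr p + (t powr (1 - p) * t powr p) * (1 - 1 / p)"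
        by (simp add: algebra_simps)
      ultimately show ?thesis by (simp add: mult.left_commute)
    qed
    have "(\<integral>\<^sup>+x. w x * u x \<partial>M) \<le>
      (\<integral>\<^sup>+x. ennreal (t powr (1 - p) / p) * ennreal (w x * u x powr p) + ennreal (t * (1 - 1 / p)) * ennreal (w x) \<partial>M)"
    proof (rule nn_integral_mono)
      fix x
      have "w x * u x \<le> w x * (t powr (1 - p) / p * u x powr p + t * (1 - 1 / p))"
        by (intro mult_left_mono young nonneg)
      also have "\<dots> = t powr (1 - p) / p * (w x * u x powr p) + t * (1 - 1 / p) * w x"
        by (simp add: algebra_simps)
      finally show "ennreal (w x * u x) \<le> ennreal (t powr (1 - p) / p) * ennreal (w x * u x powr p) + ennreal (t * (1 - 1 / p)) * ennreal (w x)"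
        using p t nonneg by (simp flip: ennreal_mult' ennreal_plus)
    qed
    also have "\<dots> = ennreal (t powr (1 - p) / p) * ennreal I + ennreal (t * (1 - 1 / p)) * ennreal \<phi>"
      by (simp add: nn_integral_add nn_integral_cmult w wu)
    also have "\<dots> = ennreal (t powr (1 - p) / p * I + t * (1 - 1 / p) * \<phi>)"
      using p t I \<phi> by (simp flip: ennreal_mult' ennreal_plus)
    finally show ?thesis .
  qed
  have "(\<integral>\<^sup>+x. w x * u x \<partial>M) < \<infinity>"
    \<comment> \<open>Any \<open>t\<close> gives finiteness.\<close>
    using bound[of 1] by (simp add: le_less_trans)
  then obtain j where j: "j \<ge> 0" "(\<integral>\<^sup>+x. w x * u x \<partial>M) = ennreal j"
    by (cases "\<integral>\<^sup>+x. w x * u x \<partial>M") auto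
  have "j powr p \<le> \<phi> powr (p - 1) * I"
  proof (cases "j = 0")
    case False
    then have j0: "j > 0" using j by simp
    \<comment> \<open>The mean of \<open>u\<close> under the normalised weight, which is the point
      of tangency in Jensen's inequality.\<close>
    define t where "t = j / \<phi>"
    have t: "t > 0" using j0 \<phi> by (simp add: t_def)
    have nn: "t powr (1 - p) / p * I + t * (1 - 1 / p) * \<phi> \<ge> 0" using p t I \<phi> by simp
    have "j \<le> t powr (1 - p) / p * I + t * (1 - 1 / p) * \<phi>"
      using bound[OF t] nn j by simp
    also have "t * (1 - 1 / p) * \<phi> = j * (1 - 1 / p)" using \<phi> by (simp add: t_def)
    finally have "j / p \<le> t powr (1 - p) * I / p" by (simp add: algebra_simps)
    then have "j \<le> t powr (1 - p) * I" using p by (simp add: divide_simps)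
    also have "t powr (1 - p) = \<phi> powr (p - 1) * j powr (1 - p)"
      using j0 \<phi> by (simp add: t_def powr_divide powr_minus_divide flip: powr_minus) 
        (simp add: powr_diff field_simps)
    finally have "j powr (p - 1) * j \<le> j powr (p - 1) * (\<phi> powr (p - 1) * j powr (1 - p) * I)"
      by (intro mult_left_mono) auto
    moreover have "j powr (p - 1) * j powr (1 - p) = 1" "j powr (p - 1) * j = j powr p"
      using j0 by (simp_all flip: powr_add powr_mult_base add: powr_diff)
    ultimately show ?thesis by (simp add: algebra_simps)
  qed (use I in auto)
  with j that show thesis by blast
qed

text \<open>Jensen is applied with weight \<open>z powr (- 1 / p) * h z\<close>, of mass \<phi>, to
  the function \<open>z powr (1 / p) * \<bar>g (x * z)\<bar>\<close>. Integrating the outcome over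
  \<open>x\<close> by Tonelli yields a second factor \<phi>, so the total is
  \<open>\<phi> powr (p - 1) * \<phi> * F\<close>.\<close>

lemma dilation_average_bound:
  fixes h g :: "real \<Rightarrow> real"
  assumes [measurable]: "h \<in> borel_measurable borel" "g \<in> borel_measurable borel"
    and h: "\<And>z. h z \<ge> 0" "\<forall>z\<le>0. h z = 0"
    and p: "p > 1" and \<phi>: "\<phi> > 0" and F: "F \<ge> 0"
    and int_h: "(\<integral>\<^sup>+z. z powr (- 1 / p) * h z \<partial>lborel) = ennreal \<phi>"
    and int_g: "(\<integral>\<^sup>+x. \<bar>g x\<bar> powr p \<partial>lborel) = ennreal F"
  shows "AE x in lborel. integrable lborel (\<lambda>z. h z * g (x * z))"
    and "(\<integral>\<^sup>+x. \<bar>\<integral>z. h z * g (x * z) \<partial>lborel\<bar> powr p \<partial>lborel) \<le> ennreal (\<phi> powr p * F)"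
proof -
  \<comment> \<open>The weighted integral of the \<open>p\<close>-th power that Jensen produces: the
    factor \<open>z powr (1 / p)\<close> becomes \<open>z\<close>, which raises the exponent of the
    weight by 1.\<close>
  define I where "I x = (\<integral>\<^sup>+z. z powr (1 - 1 / p) * h z * \<bar>g (x * z)\<bar> powr p \<partial>lborel)" for x
  have [measurable]: "I \<in> borel_measurable borel" unfolding I_def by measurable
  have "(\<integral>\<^sup>+x. I x \<partial>lborel)
      = (\<integral>\<^sup>+z. (\<integral>\<^sup>+x. z powr (1 - 1 / p) * h z * \<bar>g (x * z)\<bar> powr p \<partial>lborel) \<partial>lborel)"
    unfolding I_def by (rule lborel_pair.Fubini') measurable
  also have "\<dots> = (\<integral>\<^sup>+z. ennreal (z powr (- 1 / p) * h z) * ennreal F \<partial>lborel)"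
  proof (rule nn_integral_cong)
    fix z :: real
    show "(\<integral>\<^sup>+x. z powr (1 - 1 / p) * h z * \<bar>g (x * z)\<bar> powr p \<partial>lborel)
        = ennreal (z powr (- 1 / p) * h z) * ennreal F"
    proof (cases "z > 0")
      case True
      \<comment> \<open>The Jacobian of the dilation by \<open>z\<close> cancels the extra factor
        \<open>z\<close>, so the original weight returns.\<close>
      have "ennreal F = ennreal z * (\<integral>\<^sup>+x. \<bar>g (z * x)\<bar> powr p \<partial>lborel)"
        using True nn_integral_real_affine[of "\<lambda>x. ennreal (\<bar>g x\<bar> powr p)" z 0] by (simp add: int_g)
      moreover have "ennreal (z powr (1 - 1 / p) * h z) = ennreal (z powr (- 1 / p) * h z) * ennreal z"
        using powr_add[of z "- 1 / p" 1] True h by (simp add: mult_ac flip: ennreal_mult')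
      moreover have "(\<integral>\<^sup>+x. z powr (1 - 1 / p) * h z * \<bar>g (x * z)\<bar> powr p \<partial>lborel)
          = ennreal (z powr (1 - 1 / p) * h z) * (\<integral>\<^sup>+x. \<bar>g (z * x)\<bar> powr p \<partial>lborel)"
        using h by (subst nn_integral_cmult[symmetric]) (auto simp: ennreal_mult mult.commute[of _ z])
      ultimately show ?thesis by (simp add: mult.assoc)
    qed (use h in simp)
  qed
  also have "\<dots> = ennreal (\<phi> * F)"
    using F \<phi> int_h by (subst nn_integral_multc) (simp_all add: ennreal_mult)
  finally have int_I: "(\<integral>\<^sup>+x. I x \<partial>lborel) = ennreal (\<phi> * F)" .
  have pointwise: "integrable lborel (\<lambda>z. h z * g (x * z)) \<and>
      ennreal (\<bar>\<integral>z. h z * g (x * z) \<partial>lborel\<bar> powr p) \<le> ennreal (\<phi> powr (p - 1)) * I x"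
    if finite: "I x < \<infinity>" for x
  proof -
    obtain i where i: "i \<ge> 0" "I x = ennreal i" using finite by (cases "I x") auto
    have u: "z powr (- 1 / p) * h z * (z powr (1 / p) * \<bar>g (x * z)\<bar>) = norm (h z * g (x * z))" for z
      using h powr_add[of z "- 1 / p" "1 / p"] by (cases "z > 0") (simp_all add: abs_mult)
    have up: "z powr (- 1 / p) * h z * (z powr (1 / p) * \<bar>g (x * z)\<bar>) powr p
        = z powr (1 - 1 / p) * h z * \<bar>g (x * z)\<bar> powr p" for z
      using h p powr_add[of z "- 1 / p" 1]
      by (cases "z > 0") (simp_all add: powr_mult powr_powr mult_ac)
    have wu: "(\<integral>\<^sup>+z. z powr (- 1 / p) * h z * (z powr (1 / p) * \<bar>g (x * z)\<bar>) powr p \<partial>lborel) = ennreal i"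
      unfolding up using i(2) by (simp add: I_def)
    obtain j where j: "j \<ge> 0" "(\<integral>\<^sup>+z. norm (h z * g (x * z)) \<partial>lborel) = ennreal j"
        "j powr p \<le> \<phi> powr (p - 1) * i"
      by (rule weighted_Jensen_powr[OF _ _ _ _ p \<phi> i(1) int_h wu]) (use h in \<open>auto simp only: u intro!: mult_nonneg_nonneg powr_ge_zero abs_ge_zero\<close>, measurable)
    have int: "integrable lborel (\<lambda>z. h z * g (x * z))"
      using j(2) by (intro integrableI_bounded) auto
    have "ennreal \<bar>\<integral>z. h z * g (x * z) \<partial>lborel\<bar> \<le> ennreal j"
      using integral_norm_bound_ennreal[OF int] j(2) by simp
    then have "\<bar>\<integral>z. h z * g (x * z) \<partial>lborel\<bar> powr p \<le> \<phi> powr (p - 1) * i"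
      using j p by (intro order_trans[OF powr_mono2 j(3)]) auto
    with int i show ?thesis by (simp flip: ennreal_mult')
  qed
  \<comment> \<open>\<open>I\<close> has finite integral, so the pointwise estimate is available
    almost everywhere.\<close>
  have fin: "AE x in lborel. I x < \<infinity>"
    using nn_integral_PInf_AE[of I lborel] int_I by (simp add: less_top)
  then show "AE x in lborel. integrable lborel (\<lambda>z. h z * g (x * z))"
    by eventually_elim (use pointwise in blast)
  have "(\<integral>\<^sup>+x. \<bar>\<integral>z. h z * g (x * z) \<partial>lborel\<bar> powr p \<partial>lborel) \<le> (\<integral>\<^sup>+x. ennreal (\<phi> powr (p - 1)) * I x \<partial>lborel)"
    by (rule nn_integral_mono_AE) (use fin in \<open>eventually_elim, use pointwise in blast\<close>)
  also have "\<dots> = ennreal (\<phi> powr (p - 1)) * ennreal (\<phi> * F)"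
    by (simp add: nn_integral_cmult int_I)
  also have "\<dots> = ennreal (\<phi> powr p * F)"
    using \<phi> powr_add[of \<phi> "p - 1" 1] by (simp add: mult.assoc flip: ennreal_mult')
  finally show "(\<integral>\<^sup>+x. \<bar>\<integral>z. h z * g (x * z) \<partial>lborel\<bar> powr p \<partial>lborel) \<le> ennreal (\<phi> powr p * F)" .
qed

section \<open>Positivity of \<open>kernel_phi\<close> from the asymptotics of the kernel\<close>

text \<open>Every factor is eventually positive. The filter \<open>F\<close> is left general so that
  the endpoints 0 and infinity share one proof.\<close>

lemma eventually_pos_of_log_asymptotics:
  fixes H C S r :: "real \<Rightarrow> real"
  assumes L: "filterlim (\<lambda>z. \<bar>ln z\<bar>) at_top F"
    and S: "slowly_varying S" "\<forall>t>0. S t \<ge> 0"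
    and \<gamma>: "\<gamma> > 0" and r: "r \<in> O[F](\<lambda>z. \<bar>ln z\<bar> powr (- \<gamma>))"
    and C: "eventually (\<lambda>z. C z > 0) F"
    and H: "eventually (\<lambda>z. H z = C z * \<bar>ln z\<bar> powr \<beta> * S \<bar>ln z\<bar> * (1 + r z)) F"
  shows "eventually (\<lambda>z. H z > 0) F"
proof -
  \<comment> \<open>Slow variation at scale 1 forces \<open>S\<close> to be eventually nonzero: by
    convention the quotient is 0 wherever \<open>S z = 0\<close>, which a limit of 1
    excludes.\<close>
  have "((\<lambda>z. S (1 * z) / S z) \<longlongrightarrow> 1) at_top"
    using S(1) unfolding slowly_varying_def by (rule allE[of _ 1]) simp
  then have "eventually (\<lambda>t. S (1 * t) / S t > 0) at_top"
    by (rule order_tendstoD) simp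
  then have "eventually (\<lambda>t. t > 0 \<and> S t > 0) at_top"
    using eventually_gt_at_top[of 0]
    by eventually_elim (use S(2) in \<open>force simp: less_le\<close>)
  then have ev1: "eventually (\<lambda>z. \<bar>ln z\<bar> > 0 \<and> S \<bar>ln z\<bar> > 0) F"
    by (rule eventually_compose_filterlim[OF _ L])
  obtain c where c: "c > 0" "eventually (\<lambda>z. norm (r z) \<le> c * norm (\<bar>ln z\<bar> powr (- \<gamma>))) F"
    using landau_o.bigE[OF r] by blast
  have "((\<lambda>z. \<bar>ln z\<bar> powr (- \<gamma>)) \<longlongrightarrow> 0) F"
    using tendsto_neg_powr[OF _ L] \<gamma> by simp
  then have "(r \<longlongrightarrow> 0) F"
    by (rule tendsto_0_le[where K = c]) (use c(2) in \<open>simp add: mult.commute\<close>)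
  then have ev2: "eventually (\<lambda>z. r z > -1) F"
    by (rule order_tendstoD) simp
  from ev1 ev2 C H show ?thesis
    by eventually_elim simp
qed

lemma kernel_pos_interval:
  assumes "cond_at_zero H \<or> cond_at_infinity H"
  obtains a b where "0 \<le> a" "a < b" "\<And>z. a < z \<Longrightarrow> z < b \<Longrightarrow> H z > 0"
  using assms
proof
  have L: "filterlim (\<lambda>z::real. \<bar>ln z\<bar>) at_top (at_right 0)"
    using filterlim_at_infinity_imp_norm_at_top[OF filterlim_at_bot_imp_at_infinity[OF ln_at_0]]
    by simp
  assume "cond_at_zero H"
  then have "eventually (\<lambda>z. H z > 0) (at_right 0)"
    unfolding cond_at_zero_def
    by (auto intro: eventually_pos_of_log_asymptotics[OF L, where C = "\<lambda>_. c" for c])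
  then show thesis
    unfolding eventually_at_right_field using that[of 0] by blast
next
  have L: "filterlim (\<lambda>z::real. \<bar>ln z\<bar>) at_top at_top"
    using filterlim_at_infinity_imp_norm_at_top[OF filterlim_at_top_imp_at_infinity[OF ln_at_top]]
    by simp
  have pos: "eventually (\<lambda>z. c * (1 / z) > 0) at_top" if "c > 0" for c :: real
    using eventually_gt_at_top[of 0] by eventually_elim (use that in simp)
  assume "cond_at_infinity H"
  then have "eventually (\<lambda>z. H z > 0) at_top"
    unfolding cond_at_infinity_def
    by (auto intro: eventually_pos_of_log_asymptotics[OF L _ _ _ _ pos])
  then obtain N where "\<And>z. z \<ge> N \<Longrightarrow> H z > 0"
    unfolding eventually_at_top_linorder by blast
  then show thesis
    using that[of "max N 0" "max N 0 + 1"] by simp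
qed

text \<open>A nonnegative integrand with zero integral vanishes almost everywhere, but here it is
  positive on an interval. Positivity of \<open>kernel_phi\<close> is what allows it to be cancelled
  in quotients of norms.\<close>

lemma kernel_phi_pos:
  assumes nonneg: "\<forall>z>0. H z \<ge> 0"
    and int: "integrable pos_leb (\<lambda>z. z powr (- 1 / p) * H z)"
    and cond: "cond_at_zero H \<or> cond_at_infinity H"
  shows "kernel_phi H p > 0"
proof (rule ccontr)
  assume "\<not> kernel_phi H p > 0"
  moreover have nn: "AE z in pos_leb. 0 \<le> z powr (- 1 / p) * H z"
    using nonneg by (simp add: AE_pos_leb_iff)
  ultimately have "(\<integral>z. z powr (- 1 / p) * H z \<partial>pos_leb) = 0"
    using integral_nonneg_AE[OF nn] by (simp add: kernel_phi_def)
  then have "AE z in pos_leb. z powr (- 1 / p) * H z = 0"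
    using integral_nonneg_eq_0_iff_AE[OF int nn] by simp
  moreover obtain a b where ab: "0 \<le> a" "a < b" "\<And>z. a < z \<Longrightarrow> z < b \<Longrightarrow> H z > 0"
    using kernel_pos_interval[OF cond] by blast
  ultimately have "AE z in lborel. z \<notin> {a<..<b}"
    unfolding AE_pos_leb_iff by (auto elim!: eventually_mono) force
  then have "emeasure lborel {a<..<b} = 0"
    by (subst (asm) AE_iff_measurable[where N = "{a<..<b}"]) auto
  with ab show False by simp
qed

section \<open>Upper estimates in the \<open>L^p\<close> and \<open>G\<close> norms\<close>

lemma Lp_norm_finiteE:
  assumes "Lp_norm p f < \<infinity>"
  obtains F where "F \<ge> 0" "(\<integral>\<^sup>+x. \<bar>f x\<bar> powr p \<partial>pos_leb) = ennreal F" "Lp_norm p f = ennreal (F powr (1 / p))"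
proof (cases "\<integral>\<^sup>+x. \<bar>f x\<bar> powr p \<partial>pos_leb")
  case (real F)
  then show thesis using that by (auto simp: Lp_norm_def)
next
  case top
  then show thesis using assms by (simp add: Lp_norm_def)
qed

lemma Lp_norm_le:
  assumes "(\<integral>\<^sup>+x. \<bar>f x\<bar> powr p \<partial>pos_leb) \<le> ennreal A" "A \<ge> 0" "p > 0"
  shows "Lp_norm p f \<le> ennreal (A powr (1 / p))"
proof (cases "\<integral>\<^sup>+x. \<bar>f x\<bar> powr p \<partial>pos_leb")
  case (real F)
  then show ?thesis using assms by (auto simp: Lp_norm_def intro!: ennreal_leI powr_mono2)
qed (use assms in \<open>simp add: top_unique\<close>)

lemma Lp_norm_ge:
  assumes "ennreal A \<le> (\<integral>\<^sup>+x. \<bar>f x\<bar> powr p \<partial>pos_leb)" "A \<ge> 0" "p > 0"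
  shows "ennreal (A powr (1 / p)) \<le> Lp_norm p f"
proof (cases "\<integral>\<^sup>+x. \<bar>f x\<bar> powr p \<partial>pos_leb")
  case (real F)
  then show ?thesis using assms by (auto simp: Lp_norm_def intro!: ennreal_leI powr_mono2)
qed (use assms in \<open>simp add: Lp_norm_def\<close>)

text \<open>Taking the absolute value of a representative makes it nonnegative everywhere and
  changes nothing almost everywhere, as \<open>H\<close> is nonnegative.\<close>

lemma kernel_borel_representative:
  assumes "H \<in> borel_measurable pos_leb" "\<forall>z>0. H z \<ge> 0"
  obtains h :: "real \<Rightarrow> real" where "h \<in> borel_measurable borel" "\<And>z. h z \<ge> 0"
    "\<forall>z\<le>0. h z = 0" "AE z in pos_leb. H z = h z"
proof -
  obtain g where g: "g \<in> borel_measurable borel" "\<forall>z\<le>0. g z = 0" "AE z in pos_leb. H z = g z"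
    using pos_leb_borel_representative[OF assms(1)] by blast
  have [measurable]: "g \<in> borel_measurable borel" by fact
  show thesis
  proof (rule that[of "\<lambda>z. \<bar>g z\<bar>"])
    show "AE z in pos_leb. H z = \<bar>g z\<bar>"
      using g(3) unfolding AE_pos_leb_iff by eventually_elim (use assms(2) in force)
  qed (use g in auto)
qed

lemma
  assumes h: "h \<in> borel_measurable borel" "\<And>z. h z \<ge> 0" "\<forall>z\<le>0. h z = 0"
    "AE z in pos_leb. H z = h z"
    and int: "integrable pos_leb (\<lambda>z. z powr (- 1 / p) * H z)"
  shows integrable_kernel_phi: "integrable lborel (\<lambda>z. z powr (- 1 / p) * h z)"
    and kernel_phi_eq: "kernel_phi H p = (\<integral>z. z powr (- 1 / p) * h z \<partial>lborel)"
proof -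
  have [measurable]: "h \<in> borel_measurable borel" by fact
  have eq: "AE z in pos_leb. z powr (- 1 / p) * H z = z powr (- 1 / p) * h z"
    using h(4) by eventually_elim simp
  show "integrable lborel (\<lambda>z. z powr (- 1 / p) * h z)"
    using int by (subst (asm) integrable_pos_leb_iff[OF _ _ eq]) (use h in auto)
  show "kernel_phi H p = (\<integral>z. z powr (- 1 / p) * h z \<partial>lborel)"
    unfolding kernel_phi_def by (rule integral_pos_leb[OF _ _ eq]) (use h in auto)
qed

text \<open>After the substitution the operator is a parameter integral with jointly Borel
  integrand, hence Borel in \<open>x\<close>.\<close>

lemma borel_measurable_kernel_op:
  assumes "H \<in> borel_measurable pos_leb" "\<forall>z>0. H z \<ge> 0" "f \<in> borel_measurable pos_leb"
  shows "kernel_op H f \<in> borel_measurable pos_leb"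
proof -
  obtain h where h: "h \<in> borel_measurable borel" "\<And>z. h z \<ge> 0" "\<forall>z\<le>0. h z = 0"
      "AE z in pos_leb. H z = h z"
    using kernel_borel_representative[OF assms(1,2)] by blast
  obtain g where g: "g \<in> borel_measurable borel" "\<forall>z\<le>0. g z = 0" "AE z in pos_leb. f z = g z"
    using pos_leb_borel_representative[OF assms(3)] by blast
  note [measurable] = h(1) g(1)
  have "(\<lambda>x. \<integral>z. h z * g (x * z) \<partial>lborel) \<in> borel_measurable pos_leb"
    by (rule borel_imp_measurable_pos_leb) measurable
  then show ?thesis
    by (rule borel_measurable_pos_leb_AE)
      (simp add: AE_pos_leb_iff kernel_op_eq[OF h(1) g(1) h(3) g(2) h(4) g(3)])
qed

text \<open>Transfers the estimate for averages of dilations to \<open>kernel_op\<close> through the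
  representatives \<open>h\<close> and \<open>g\<close>, then takes \<open>p\<close>-th
  roots.\<close>

lemma
  assumes H: "H \<in> borel_measurable pos_leb" "\<forall>z>0. H z \<ge> 0"
    and int: "integrable pos_leb (\<lambda>z. z powr (- 1 / p) * H z)" and pos: "kernel_phi H p > 0"
    and f: "f \<in> borel_measurable pos_leb" "Lp_norm p f < \<infinity>" and p: "p > 1"
  shows AE_integrable_kernel: "AE x in pos_leb. integrable pos_leb (\<lambda>y. 1 / x * H (y / x) * f y)"
    and Lp_norm_kernel_op_le: "Lp_norm p (kernel_op H f) \<le> ennreal (kernel_phi H p) * Lp_norm p f"
proof -
  obtain h where h: "h \<in> borel_measurable borel" "\<And>z. h z \<ge> 0" "\<forall>z\<le>0. h z = 0"
      "AE z in pos_leb. H z = h z"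
    using kernel_borel_representative[OF H] by blast
  obtain g where g: "g \<in> borel_measurable borel" "\<forall>z\<le>0. g z = 0" "AE z in pos_leb. f z = g z"
    using pos_leb_borel_representative[OF f(1)] by blast
  note [measurable] = h(1) g(1)
  note kernel = kernel_integrable_iff[OF h(1) g(1) h(3) g(2) h(4) g(3)]
    kernel_op_eq[OF h(1) g(1) h(3) g(2) h(4) g(3)]
  obtain F where F: "F \<ge> 0" "(\<integral>\<^sup>+x. \<bar>f x\<bar> powr p \<partial>pos_leb) = ennreal F"
      "Lp_norm p f = ennreal (F powr (1 / p))"
    using Lp_norm_finiteE[OF f(2)] by blast
  have "(\<integral>\<^sup>+x. \<bar>f x\<bar> powr p \<partial>pos_leb) = (\<integral>\<^sup>+x. \<bar>g x\<bar> powr p \<partial>pos_leb)"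
    by (rule nn_integral_cong_AE) (use g(3) in \<open>eventually_elim, simp\<close>)
  also have "\<dots> = (\<integral>\<^sup>+x. \<bar>g x\<bar> powr p \<partial>lborel)"
    unfolding nn_integral_pos_leb by (intro nn_integral_cong) (use g(2) in \<open>auto simp: indicator_def\<close>)
  finally have int_g: "(\<integral>\<^sup>+x. \<bar>g x\<bar> powr p \<partial>lborel) = ennreal F" using F by simp
  have int_h: "(\<integral>\<^sup>+z. z powr (- 1 / p) * h z \<partial>lborel) = ennreal (kernel_phi H p)"
    using nn_integral_eq_integral[OF integrable_kernel_phi[OF h int]] h kernel_phi_eq[OF h int] by simp
  note bound = dilation_average_bound[OF h(1) g(1) h(2,3) p pos F(1) int_h int_g]
  show "AE x in pos_leb. integrable pos_leb (\<lambda>y. 1 / x * H (y / x) * f y)"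
    using bound(1) unfolding AE_pos_leb_iff by eventually_elim (use kernel(1) in blast)
  have "(\<integral>\<^sup>+x. \<bar>kernel_op H f x\<bar> powr p \<partial>pos_leb)
      \<le> (\<integral>\<^sup>+x. \<bar>\<integral>z. h z * g (x * z) \<partial>lborel\<bar> powr p \<partial>lborel)"
    unfolding nn_integral_pos_leb
    by (intro nn_integral_mono) (auto simp: indicator_def kernel(2))
  also have "\<dots> \<le> ennreal (kernel_phi H p powr p * F)" by (rule bound(2))
  finally have "Lp_norm p (kernel_op H f) \<le> ennreal ((kernel_phi H p powr p * F) powr (1 / p))"
    using F p by (intro Lp_norm_le) auto
  also have "\<dots> = ennreal (kernel_phi H p) * Lp_norm p f"
    using F p pos by (simp add: powr_mult powr_powr ennreal_mult)
  finally show "Lp_norm p (kernel_op H f) \<le> ennreal (kernel_phi H p) * Lp_norm p f" .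
qed

lemma Lp_norm_le_G_norm:
  assumes "p > 1" "\<psi> p > 0"
  shows "Lp_norm p f \<le> ennreal (\<psi> p) * G_norm \<psi> f"
proof -
  have "Lp_norm p f = ennreal (\<psi> p) * (Lp_norm p f / ennreal (\<psi> p))"
    using assms by (simp add: ennreal_times_divide mult.commute[of "ennreal _"] ennreal_mult_divide_eq)
  also have "\<dots> \<le> ennreal (\<psi> p) * G_norm \<psi> f"
    unfolding G_norm_def using assms by (intro mult_left_mono SUP_upper) auto
  finally show ?thesis .
qed

lemma
  assumes H: "H \<in> borel_measurable pos_leb" "\<forall>z>0. H z \<ge> 0"
    and int: "\<And>p. p > 1 \<Longrightarrow> integrable pos_leb (\<lambda>z. z powr (- 1 / p) * H z)"
    and pos: "\<And>p. p > 1 \<Longrightarrow> kernel_phi H p > 0"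
    and \<psi>: "\<And>p. p > 1 \<Longrightarrow> \<psi> p > 0" and f: "f \<in> G_space \<psi>"
  shows AE_integrable_kernel_G: "AE x in pos_leb. integrable pos_leb (\<lambda>y. 1 / x * H (y / x) * f y)"
    and G_norm_kernel_op_le: "G_norm (\<lambda>p. kernel_phi H p * \<psi> p) (kernel_op H f) \<le> G_norm \<psi> f"
    and kernel_op_G_space: "kernel_op H f \<in> G_space (\<lambda>p. kernel_phi H p * \<psi> p)"
proof -
  have fm: "f \<in> borel_measurable pos_leb" and fG: "G_norm \<psi> f < \<infinity>"
    using f by (auto simp: G_space_def)
  have fin: "Lp_norm p f < \<infinity>" if "p > 1" for p
    using Lp_norm_le_G_norm[of p \<psi> f] that \<psi> fG
    by (auto intro!: le_less_trans[of "Lp_norm p f"] simp: ennreal_mult_less_top)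
  show "AE x in pos_leb. integrable pos_leb (\<lambda>y. 1 / x * H (y / x) * f y)"
    \<comment> \<open>The claim does not mention \<open>p\<close>, so a single exponent
      suffices.\<close>
    by (rule AE_integrable_kernel[where p = 2, OF H]) (use int pos fm fin in auto)
  show le: "G_norm (\<lambda>p. kernel_phi H p * \<psi> p) (kernel_op H f) \<le> G_norm \<psi> f"
    unfolding G_norm_def
  \<comment> \<open>The comparison is made at each exponent separately, where the factor
    \<open>kernel_phi H p\<close> cancels.\<close>
  proof (rule SUP_mono)
    fix p :: real assume "p \<in> {1<..}"
    then have p: "p > 1" by simp
    have "Lp_norm p (kernel_op H f) / ennreal (kernel_phi H p * \<psi> p)
        \<le> (ennreal (kernel_phi H p) * Lp_norm p f) / (ennreal (kernel_phi H p) * ennreal (\<psi> p))"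
      using Lp_norm_kernel_op_le[OF H int[OF p] pos[OF p] fm fin[OF p] p] pos[OF p] \<psi>[OF p]
      by (simp add: ennreal_mult divide_right_mono_ennreal)
    also have "\<dots> = Lp_norm p f / ennreal (\<psi> p)"
      using pos[OF p] by (simp add: divide_mult_eq mult.commute[of "ennreal (kernel_phi H p)"])
    finally show "\<exists>m\<in>{1<..}. Lp_norm p (kernel_op H f) / ennreal (kernel_phi H p * \<psi> p)
        \<le> Lp_norm m f / ennreal (\<psi> m)" using p by auto
  qed
  show "kernel_op H f \<in> G_space (\<lambda>p. kernel_phi H p * \<psi> p)"
    using le fG borel_measurable_kernel_op[OF H fm] by (auto simp: G_space_def intro: le_less_trans)
qed

section \<open>Extremal functions and their weights\<close>

text \<open>The exponent is critical for \<open>p = 2\<close>: on the window the square is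
  \<open>1 / x\<close>, which is constant density in the coordinate \<open>ln x\<close>.\<close>

definition log_cutoff :: "real \<Rightarrow> real \<Rightarrow> real"
  where "log_cutoff n x = x powr (- 1 / 2) * indicator {exp (- n)..exp n} x"

text \<open>A closed-form bound for the \<open>L^p\<close> norm of \<open>log_cutoff n\<close>, from
  which continuity and both limits can be read off. The base \<open>2 * n\<close> is the logarithmic
  length of the window; the exponential equals 1 at \<open>p = 2\<close>.\<close>

definition log_cutoff_weight :: "real \<Rightarrow> real \<Rightarrow> real"
  where "log_cutoff_weight n p = (2 * n) powr (1 / p) * exp (n * \<bar>1 / 2 - 1 / p\<bar>)"

lemma borel_measurable_log_cutoff [measurable]: "log_cutoff n \<in> borel_measurable borel"
  unfolding log_cutoff_def by measurable

lemma nn_integral_inverse_log_interval: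
  assumes "n \<ge> 0" "c \<ge> 0"
  shows "(\<integral>\<^sup>+x. ennreal (c / x) * indicator {exp (- n)..exp n} x \<partial>lborel) = ennreal (c * (2 * n))"
proof -
  have "(\<integral>\<^sup>+x. ennreal (c / x) * indicator {exp (- n)..exp n} x \<partial>lborel)
      = ennreal (c * ln (exp n) - c * ln (exp (- n)))"
  proof (rule nn_integral_FTC_Icc)
    fix x :: real assume "x \<in> {exp (- n)..exp n}"
    then have "x > 0" by (auto intro: less_le_trans[OF exp_gt_zero])
    then show "((\<lambda>x. c * ln x) has_field_derivative c / x) (at x)" "0 \<le> c / x"
      using assms by (auto intro!: derivative_eq_intros)
  qed (use assms in auto)
  then show ?thesis by (simp add: algebra_simps)
qed

text \<open>On the window the \<open>p\<close>-th power is \<open>x powr (1 - p / 2)\<close> times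
  \<open>1 / x\<close>. The first factor is at most its maximum there, and the second integrates to
  \<open>2 * n\<close>.\<close>

lemma Lp_norm_log_cutoff_le:
  assumes n: "n > 0" and p: "p > 1"
  shows "Lp_norm p (log_cutoff n) \<le> ennreal (log_cutoff_weight n p)"
proof -
  \<comment> \<open>The maximum of \<open>x powr (1 - p / 2)\<close> over the window, attained at an
    endpoint.\<close>
  define M where "M = exp (n * \<bar>1 - p / 2\<bar>)"
  have le: "\<bar>log_cutoff n x\<bar> powr p \<le> M / x" if x: "x \<in> {exp (- n)..exp n}" for x
  proof -
    have x0: "x > 0" using x by (auto intro: less_le_trans[OF exp_gt_zero])
    then have "\<bar>ln x\<bar> \<le> n"
      using x ln_le_cancel_iff[of "exp (- n)" x] ln_le_cancel_iff[of x "exp n"] by auto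
    then have "\<bar>1 - p / 2\<bar> * \<bar>ln x\<bar> \<le> n * \<bar>1 - p / 2\<bar>"
      by (subst mult.commute) (intro mult_right_mono, auto)
    then have "(1 - p / 2) * ln x \<le> n * \<bar>1 - p / 2\<bar>"
      using abs_ge_self[of "(1 - p / 2) * ln x"] by (simp add: abs_mult)
    then have "x powr (1 - p / 2) \<le> M"
      using x0 by (simp add: powr_def M_def)
    moreover have "\<bar>log_cutoff n x\<bar> powr p = x powr (- p / 2)"
      using x x0 by (simp add: log_cutoff_def powr_powr)
    moreover have "x powr (- p / 2) * x = x powr (1 - p / 2)"
      using x0 powr_add[of x "- p / 2" 1] by simp
    ultimately show ?thesis using x0 by (simp add: field_simps)
  qed
  have "(\<integral>\<^sup>+x. \<bar>log_cutoff n x\<bar> powr p \<partial>pos_leb)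
      \<le> (\<integral>\<^sup>+x. ennreal (M / x) * indicator {exp (- n)..exp n} x \<partial>lborel)"
    unfolding nn_integral_pos_leb
  proof (rule nn_integral_mono)
    fix x :: real
    show "ennreal (\<bar>log_cutoff n x\<bar> powr p) * indicator {0<..} x
        \<le> ennreal (M / x) * indicator {exp (- n)..exp n} x"
      using le[of x] by (cases "x \<in> {exp (- n)..exp n}") (auto simp: indicator_def log_cutoff_def intro: ennreal_leI)
  qed
  also have "\<dots> = ennreal (M * (2 * n))"
    using n by (intro nn_integral_inverse_log_interval) (auto simp: M_def)
  finally have "Lp_norm p (log_cutoff n) \<le> ennreal ((M * (2 * n)) powr (1 / p))"
    using n p by (intro Lp_norm_le) (auto simp: M_def)
  also have "M powr (1 / p) = exp (n * \<bar>1 / 2 - 1 / p\<bar>)"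
  proof -
    have "\<bar>1 - p / 2\<bar> / p = \<bar>(1 - p / 2) / p\<bar>" using p by simp
    also have "(1 - p / 2) / p = - (1 / 2 - 1 / p)" using p by (simp add: field_simps)
    finally have "\<bar>1 - p / 2\<bar> / p = \<bar>1 / 2 - 1 / p\<bar>" by (simp only: abs_minus_cancel)
    then have "n * \<bar>1 - p / 2\<bar> / p = n * \<bar>1 / 2 - 1 / p\<bar>" by (simp only: times_divide_eq_right[symmetric])
    then show ?thesis by (simp add: M_def powr_def)
  qed
  then have "(M * (2 * n)) powr (1 / p) = log_cutoff_weight n p"
    using n by (simp add: powr_mult M_def log_cutoff_weight_def)
  finally show ?thesis .
qed

text \<open>For \<open>n \<ge> 1\<close> both factors are at least 1, so the infimum is positive.
  Both limits are finite, since the formula is continuous at \<open>p = 1\<close> and depends on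
  \<open>p\<close> only through \<open>1 / p\<close>.\<close>

lemma log_cutoff_weight_Psi_class:
  assumes n: "n \<ge> 1"
  shows "log_cutoff_weight n \<in> Psi_class"
proof -
  have ge: "log_cutoff_weight n p \<ge> 1" if "p > 1" for p
  proof -
    have "(2 * n) powr (1 / p) \<ge> 1" "exp (n * \<bar>1 / 2 - 1 / p\<bar>) \<ge> 1"
      using n that by (auto intro: ge_one_powr_ge_zero)
    then have "1 * 1 \<le> (2 * n) powr (1 / p) * exp (n * \<bar>1 / 2 - 1 / p\<bar>)" by (intro mult_mono) auto
    then show ?thesis by (simp add: log_cutoff_weight_def)
  qed
  have pos: "log_cutoff_weight n p > 0" for p
    using n by (simp add: log_cutoff_weight_def)
  have "(log_cutoff_weight n \<longlongrightarrow> log_cutoff_weight n 1) (at_right 1)"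
    unfolding log_cutoff_weight_def using n by (intro tendsto_intros) auto
  then have "\<exists>L>0. ((\<lambda>p. ereal (log_cutoff_weight n p)) \<longlongrightarrow> L) (at_right 1)"
    using pos by (intro exI[of _ "ereal (log_cutoff_weight n 1)"]) simp
  moreover have "((\<lambda>p::real. 1 / p) \<longlongrightarrow> 0) at_top"
    by (rule tendsto_divide_0[OF tendsto_const filterlim_at_top_imp_at_infinity[OF filterlim_ident]])
  then have "(log_cutoff_weight n \<longlongrightarrow> (2 * n) powr 0 * exp (n * \<bar>1 / 2 - 0\<bar>)) at_top"
    unfolding log_cutoff_weight_def using n by (intro tendsto_intros) auto
  then have "\<exists>L>0. ((\<lambda>p. ereal (log_cutoff_weight n p)) \<longlongrightarrow> L) at_top"
    using n by (intro exI[of _ "ereal ((2 * n) powr 0 * exp (n * \<bar>1 / 2 - 0\<bar>))"]) simp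
  moreover have "(INF p\<in>{1<..}. log_cutoff_weight n p) \<ge> 1"
    by (rule cINF_greatest) (use ge in auto)
  moreover have "continuous_on {1<..} (log_cutoff_weight n)"
    unfolding log_cutoff_weight_def using n by (intro continuous_intros) auto
  ultimately show ?thesis
    unfolding Psi_class_def using pos by auto
qed

lemma
  assumes n: "n \<ge> 1"
  shows G_norm_log_cutoff_le: "G_norm (log_cutoff_weight n) (log_cutoff n) \<le> 1"
    and log_cutoff_G_space: "log_cutoff n \<in> G_space (log_cutoff_weight n)"
proof -
  have pos: "log_cutoff_weight n p > 0" for p
    using n by (simp add: log_cutoff_weight_def)
  show le: "G_norm (log_cutoff_weight n) (log_cutoff n) \<le> 1"
    unfolding G_norm_def
  proof (rule SUP_least)
    fix p :: real assume "p \<in> {1<..}"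
    then have "Lp_norm p (log_cutoff n) / ennreal (log_cutoff_weight n p)
        \<le> ennreal (log_cutoff_weight n p) / ennreal (log_cutoff_weight n p)"
      using n by (intro divide_right_mono_ennreal Lp_norm_log_cutoff_le) auto
    then show "Lp_norm p (log_cutoff n) / ennreal (log_cutoff_weight n p) \<le> 1"
      using pos[of p] by simp
  qed
  show "log_cutoff n \<in> G_space (log_cutoff_weight n)"
    using borel_imp_measurable_pos_leb[OF borel_measurable_log_cutoff] le
    by (auto simp: G_space_def intro: le_less_trans)
qed

lemma log_cutoff_nonzero:
  assumes "n > 0"
  shows "\<not> (AE x in pos_leb. log_cutoff n x = 0)"
proof
  assume "AE x in pos_leb. log_cutoff n x = 0"
  then have "AE x in lborel. x \<notin> {exp (- n)..exp n}"
    unfolding AE_pos_leb_iff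
    by eventually_elim (auto simp: log_cutoff_def less_le_trans[OF exp_gt_zero])
  then have "emeasure lborel {exp (- n)..exp n} = 0"
    by (subst (asm) AE_iff_measurable[where N = "{exp (- n)..exp n}"]) auto
  with assms show False by simp
qed

section \<open>Lower bound for the ratio of norms\<close>

text \<open>Dominated convergence: the windows exhaust the half-line, and \<open>h\<close> vanishes
  off it.\<close>

lemma kernel_phi_truncation:
  fixes h :: "real \<Rightarrow> real"
  assumes "h \<in> borel_measurable borel" "\<forall>z\<le>0. h z = 0"
    and int: "integrable lborel (\<lambda>z. z powr a * h z)"
  shows "(\<lambda>k. \<integral>z. indicator {exp (- real k)..exp (real k)} z * (z powr a * h z) \<partial>lborel)
    \<longlonglongrightarrow> (\<integral>z. z powr a * h z \<partial>lborel)"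
proof (rule integral_dominated_convergence)
  have [measurable]: "h \<in> borel_measurable borel" by fact
  show "(\<lambda>z. z powr a * h z) \<in> borel_measurable lborel"
    "(\<lambda>z. indicator {exp (- real k)..exp (real k)} z * (z powr a * h z)) \<in> borel_measurable lborel" for k
    by measurable
  show "integrable lborel (\<lambda>z. \<bar>z powr a * h z\<bar>)" using int by simp
  show "AE z in lborel. (\<lambda>k. indicator {exp (- real k)..exp (real k)} z * (z powr a * h z)) \<longlonglongrightarrow> z powr a * h z"
  proof (rule AE_I2, cases)
    fix z :: real assume z: "z > 0"
    have "eventually (\<lambda>k. real k \<ge> \<bar>ln z\<bar>) sequentially"
      using filterlim_real_sequentially unfolding filterlim_at_top by blast
    then have "eventually (\<lambda>k. indicator {exp (- real k)..exp (real k)} z * (z powr a * h z) = z powr a * h z) sequentially"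
    proof eventually_elim
      case (elim k)
      then have "exp (- real k) \<le> exp (ln z)" "exp (ln z) \<le> exp (real k)" by (auto simp only: exp_le_cancel_iff)
      with z show ?case by simp
    qed
    then show "(\<lambda>k. indicator {exp (- real k)..exp (real k)} z * (z powr a * h z)) \<longlonglongrightarrow> z powr a * h z"
      by (rule tendsto_eventually)
  qed (use assms(2) in auto)
qed (auto simp: indicator_def)

text \<open>For \<open>x\<close> in the shrunk window the truncated power \<open>log_cutoff n\<close> agrees, on the bulk of the
  mass of the kernel, with the eigenfunction \<open>y powr (-1/2)\<close> of the kernel operator.\<close>

lemma kernel_op_log_cutoff_ge:
  fixes h :: "real \<Rightarrow> real"
  assumes "h \<in> borel_measurable borel" "\<And>z. h z \<ge> 0"
    and int: "integrable lborel (\<lambda>z. z powr (- 1 / 2) * h z)"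
    and intx: "integrable lborel (\<lambda>z. h z * log_cutoff n (x * z))"
    and x: "x \<in> {exp (- (n - k))..exp (n - k)}"
  shows "(\<integral>z. indicator {exp (- k)..exp k} z * (z powr (- 1 / 2) * h z) \<partial>lborel) * x powr (- 1 / 2)
    \<le> (\<integral>z. h z * log_cutoff n (x * z) \<partial>lborel)"
proof -
  have [measurable]: "h \<in> borel_measurable borel" by fact
  have x0: "x > 0" using x by (auto intro: less_le_trans[OF exp_gt_zero])
  have "(\<integral>z. indicator {exp (- k)..exp k} z * (z powr (- 1 / 2) * h z) * x powr (- 1 / 2) \<partial>lborel)
      \<le> (\<integral>z. h z * log_cutoff n (x * z) \<partial>lborel)"
  proof (rule integral_mono[OF _ intx])
    show "integrable lborel (\<lambda>z. indicator {exp (- k)..exp k} z * (z powr (- 1 / 2) * h z) * x powr (- 1 / 2))"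
      using integrable_mult_indicator[OF _ int, of "{exp (- k)..exp k}"]
      by (intro integrable_mult_left) simp
    fix z :: real
    show "indicator {exp (- k)..exp k} z * (z powr (- 1 / 2) * h z) * x powr (- 1 / 2) \<le> h z * log_cutoff n (x * z)"
    proof (cases "z \<in> {exp (- k)..exp k}")
      case True
      then have z0: "z > 0" by (auto intro: less_le_trans[OF exp_gt_zero])
      \<comment> \<open>The exponents \<open>n - k\<close> and \<open>k\<close> add up to
        \<open>n\<close>, so \<open>x * z\<close> stays inside the window of
        \<open>log_cutoff n\<close>, where the power factors as
        \<open>x powr (- 1 / 2) * z powr (- 1 / 2)\<close>.\<close>
      have "exp (- (n - k)) * exp (- k) \<le> x * z" "x * z \<le> exp (n - k) * exp k"
        using True x x0 z0 by (intro mult_mono; auto)+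
      then have "x * z \<in> {exp (- n)..exp n}" by (simp flip: exp_add)
      then show ?thesis using True x0 z0 by (simp add: log_cutoff_def powr_mult)
    qed (use assms(2) in \<open>simp add: log_cutoff_def\<close>)
  qed
  then show ?thesis by simp
qed

text \<open>Covers \<open>b = 0\<close> as well, where the quotient is \<open>top\<close>, or 0 if
  \<open>a = 0\<close>.\<close>

lemma ennreal_le_divide_self:
  fixes a b :: ennreal
  assumes "b \<le> 1"
  shows "a \<le> a / b"
proof (cases "b = 0")
  case False
  then have "a = a * b / b"
    using assms by (intro ennreal_mult_divide_eq[symmetric]) (auto simp: top_unique)
  also have "\<dots> \<le> a / b"
    using mult_left_mono[OF assms, of a] by (intro divide_right_mono_ennreal) simp
  finally show ?thesis .
qed simp

text \<open>One factor \<open>s\<close> pays for truncating the kernel to a fixed window given by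
  \<open>k\<close>, the other for shrinking the window of \<open>x\<close> from \<open>n\<close> to
  \<open>n - k\<close>.\<close>

lemma kernel_op_log_cutoff_ratio:
  assumes H: "H \<in> borel_measurable pos_leb" "\<forall>z>0. H z \<ge> 0"
    and int: "integrable pos_leb (\<lambda>z. z powr (- 1 / 2) * H z)" and pos: "kernel_phi H 2 > 0"
    and s: "0 < s" "s < 1"
  obtains n where "n \<ge> 1"
    "ennreal (s ^ 2) \<le> G_norm (\<lambda>p. kernel_phi H p * log_cutoff_weight n p) (kernel_op H (log_cutoff n))
      / G_norm (log_cutoff_weight n) (log_cutoff n)"
proof -
  define \<phi> where "\<phi> = kernel_phi H 2"
  have \<phi>: "\<phi> > 0" using pos by (simp add: \<phi>_def)
  obtain h where h: "h \<in> borel_measurable borel" "\<And>z. h z \<ge> 0" "\<forall>z\<le>0. h z = 0"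
      "AE z in pos_leb. H z = h z"
    using kernel_borel_representative[OF H] by blast
  have int_h: "integrable lborel (\<lambda>z. z powr (- 1 / 2) * h z)"
    by (rule integrable_kernel_phi[OF h int])
  have "(\<lambda>k. \<integral>z. indicator {exp (- real k)..exp (real k)} z * (z powr (- 1 / 2) * h z) \<partial>lborel) \<longlonglongrightarrow> \<phi>"
    unfolding \<phi>_def kernel_phi_eq[OF h int] by (rule kernel_phi_truncation[OF h(1,3) int_h])
  then have "eventually (\<lambda>k. (\<integral>z. indicator {exp (- real k)..exp (real k)} z * (z powr (- 1 / 2) * h z) \<partial>lborel) > s * \<phi>) sequentially"
    by (rule order_tendstoD) (use s \<phi> in simp)
  then obtain k :: nat where
    k: "(\<integral>z. indicator {exp (- real k)..exp (real k)} z * (z powr (- 1 / 2) * h z) \<partial>lborel) > s * \<phi>"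
    unfolding eventually_sequentially by blast
  have s2: "1 - s ^ 2 > 0" using s by (simp add: power_less_one_iff)
  \<comment> \<open>Large enough that the shrunk window keeps at least the fraction
    \<open>s ^ 2\<close> of the logarithmic length; the lower bound 1 puts the weight into
    \<open>Psi_class\<close>.\<close>
  define n where "n = max 1 (real k / (1 - s ^ 2))"
  have n: "n \<ge> 1" by (simp add: n_def)
  have "real k / (1 - s ^ 2) \<le> n" by (simp add: n_def)
  then have nk: "s ^ 2 * n \<le> n - real k" using s2 by (simp add: field_simps)
  have nk0: "n - real k \<ge> 0" using nk n by (smt (verit) zero_le_mult_iff zero_le_power2)
  define f where "f = log_cutoff n"
  have f0: "\<forall>x\<le>0. f x = 0"
    by (auto simp: f_def log_cutoff_def indicator_def dest: order_trans[OF less_imp_le[OF exp_gt_zero]])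
  have f: "f \<in> borel_measurable borel" "AE x in pos_leb. f x = f x" by (auto simp: f_def)
  note kernel = kernel_integrable_iff[OF h(1) f(1) h(3) f0 h(4) f(2)]
    kernel_op_eq[OF h(1) f(1) h(3) f0 h(4) f(2)]
  have fL2: "Lp_norm 2 f < \<infinity>"
    using Lp_norm_log_cutoff_le[of n 2] n by (auto simp: f_def intro: le_less_trans)
  \<comment> \<open>The pointwise lower bound compares Bochner integrals and so requires
    integrability, which the upper estimate at exponent 2 supplies for almost every
    \<open>x\<close>.\<close>
  have "AE x in pos_leb. integrable pos_leb (\<lambda>y. 1 / x * H (y / x) * f y)"
    by (rule AE_integrable_kernel[OF H int pos borel_imp_measurable_pos_leb[OF f(1)] fL2]) simp
  then have ae: "AE x in lborel. x > 0 \<longrightarrow> integrable lborel (\<lambda>z. h z * f (x * z))"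
    unfolding AE_pos_leb_iff by eventually_elim (use kernel(1) in blast)
  have "ennreal ((s * \<phi>) ^ 2 * (2 * (n - real k)))
      = (\<integral>\<^sup>+x. ennreal ((s * \<phi>) ^ 2 / x) * indicator {exp (- (n - real k))..exp (n - real k)} x \<partial>lborel)"
    using nk0 by (intro nn_integral_inverse_log_interval[symmetric]) auto
  also have "\<dots> \<le> (\<integral>\<^sup>+x. \<bar>kernel_op H f x\<bar> powr 2 \<partial>pos_leb)"
    unfolding nn_integral_pos_leb
  proof (rule nn_integral_mono_AE, use ae in eventually_elim)
    case (elim x)
    show ?case
    proof (cases "x \<in> {exp (- (n - real k))..exp (n - real k)}")
      case True
      then have x0: "x > 0" by (auto intro: less_le_trans[OF exp_gt_zero])
      have "s * \<phi> * x powr (- 1 / 2) \<le>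
          (\<integral>z. indicator {exp (- real k)..exp (real k)} z * (z powr (- 1 / 2) * h z) \<partial>lborel) * x powr (- 1 / 2)"
        using k by (intro mult_right_mono) auto
      also have "\<dots> \<le> kernel_op H f x"
        unfolding kernel(2)[OF x0]
        using kernel_op_log_cutoff_ge[OF h(1,2) int_h _ True] elim x0 by (simp add: f_def)
      finally have "(s * \<phi> * x powr (- 1 / 2)) powr 2 \<le> \<bar>kernel_op H f x\<bar> powr 2"
        using s \<phi> by (intro powr_mono2) auto
      moreover have "(s * \<phi> * x powr (- 1 / 2)) powr 2 = (s * \<phi>) ^ 2 / x"
        using s \<phi> x0 by (simp add: powr_minus_divide powr_half_sqrt power_divide power_mult_distrib)
      ultimately show ?thesis using True x0 by (simp add: ennreal_leI)
    qed simp
  qed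
  finally have "ennreal (((s * \<phi>) ^ 2 * (2 * (n - real k))) powr (1 / 2)) \<le> Lp_norm 2 (kernel_op H f)"
    by (rule Lp_norm_ge) (use nk0 in auto)
  moreover have "s ^ 2 * (\<phi> * log_cutoff_weight n 2) \<le> ((s * \<phi>) ^ 2 * (2 * (n - real k))) powr (1 / 2)"
  proof -
    \<comment> \<open>At \<open>p = 2\<close> the weight is the square root of \<open>2 * n\<close>.
      Of the two factors \<open>s\<close>, one joins \<phi> and the other enters the root as
      \<open>s ^ 2 * n\<close>, to be compared with \<open>n - k\<close>.\<close>
    have "s ^ 2 * (\<phi> * log_cutoff_weight n 2) = ((s * \<phi>) ^ 2 * (2 * (s ^ 2 * n))) powr (1 / 2)"
      using s \<phi> n by (simp add: log_cutoff_weight_def powr_half_sqrt real_sqrt_mult power2_eq_square)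
    also have "\<dots> \<le> ((s * \<phi>) ^ 2 * (2 * (n - real k))) powr (1 / 2)"
      using nk n by (intro powr_mono2 mult_left_mono) auto
    finally show ?thesis .
  qed
  ultimately have "ennreal (s ^ 2) * ennreal (\<phi> * log_cutoff_weight n 2) \<le> Lp_norm 2 (kernel_op H f)"
    using s \<phi> by (simp flip: ennreal_mult') (meson ennreal_leI order_trans)
  then have "ennreal (s ^ 2) * ennreal (\<phi> * log_cutoff_weight n 2) / ennreal (\<phi> * log_cutoff_weight n 2)
      \<le> Lp_norm 2 (kernel_op H f) / ennreal (\<phi> * log_cutoff_weight n 2)"
    by (rule divide_right_mono_ennreal)
  moreover have "\<phi> * log_cutoff_weight n 2 > 0" using \<phi> n by (simp add: log_cutoff_weight_def)
  then have "ennreal (s ^ 2) * ennreal (\<phi> * log_cutoff_weight n 2) / ennreal (\<phi> * log_cutoff_weight n 2) = ennreal (s ^ 2)"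
    by (intro ennreal_mult_divide_eq) (simp_all only: ennreal_eq_0_iff not_le ennreal_neq_top, simp)
  ultimately have "ennreal (s ^ 2) \<le> Lp_norm 2 (kernel_op H f) / ennreal (\<phi> * log_cutoff_weight n 2)"
    by (simp only:)
  also have "\<dots> \<le> G_norm (\<lambda>p. kernel_phi H p * log_cutoff_weight n p) (kernel_op H f)"
    unfolding G_norm_def \<phi>_def by (rule SUP_upper) simp
  \<comment> \<open>The denominator is at most 1, so dividing by it can only increase the
    value.\<close>
  also have "\<dots> \<le> G_norm (\<lambda>p. kernel_phi H p * log_cutoff_weight n p) (kernel_op H f) / G_norm (log_cutoff_weight n) f"
    unfolding f_def by (rule ennreal_le_divide_self[OF G_norm_log_cutoff_le[OF n]])
  finally show thesis using that n by (simp add: f_def)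
qed

text \<open>The integrability clause ensures that the values of \<open>kernel_op\<close> are genuine
  integrals almost everywhere and not the default 0. Nonzero functions are understood modulo null
  sets.\<close>

theorem theorem3:
  fixes H :: "real \<Rightarrow> real"
  assumes "H \<in> borel_measurable pos_leb"
    and "\<And>z. z > 0 \<Longrightarrow> H z \<ge> 0"
    and "\<And>p. p > 1 \<Longrightarrow> integrable pos_leb (\<lambda>z. z powr (- 1 / p) * H z)"
    and "cond_at_zero H \<or> cond_at_infinity H"
  shows "(\<forall>\<psi> \<in> Psi_class. \<forall>f \<in> G_space \<psi>.
            (AE x in pos_leb. integrable pos_leb (\<lambda>y. 1 / x * H (y / x) * f y)) \<and>
            kernel_op H f \<in> G_space (\<lambda>p. kernel_phi H p * \<psi> p) \<and>
            G_norm (\<lambda>p. kernel_phi H p * \<psi> p) (kernel_op H f) \<le> G_norm \<psi> f) \<and>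
         (SUP \<psi> \<in> Psi_class. SUP f \<in> {f \<in> G_space \<psi>. \<not> (AE x in pos_leb. f x = 0)}.
            G_norm (\<lambda>p. kernel_phi H p * \<psi> p) (kernel_op H f) / G_norm \<psi> f) = 1"
proof (intro conjI antisym)
  have nonneg: "\<forall>z>0. H z \<ge> 0" using assms(2) by blast
  have pos: "kernel_phi H p > 0" if "p > 1" for p
    by (rule kernel_phi_pos[OF nonneg assms(3)[OF that] assms(4)])
  have Psi_pos: "\<psi> p > 0" if "\<psi> \<in> Psi_class" "p > 1" for \<psi> p
    using that by (simp add: Psi_class_def)
  note bounds = AE_integrable_kernel_G G_norm_kernel_op_le kernel_op_G_space
  show bound: "\<forall>\<psi> \<in> Psi_class. \<forall>f \<in> G_space \<psi>.
      (AE x in pos_leb. integrable pos_leb (\<lambda>y. 1 / x * H (y / x) * f y)) \<and>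
      kernel_op H f \<in> G_space (\<lambda>p. kernel_phi H p * \<psi> p) \<and>
      G_norm (\<lambda>p. kernel_phi H p * \<psi> p) (kernel_op H f) \<le> G_norm \<psi> f"
    by (intro ballI conjI bounds[OF assms(1) nonneg assms(3) pos Psi_pos])
  let ?ratio = "\<lambda>\<psi> f. G_norm (\<lambda>p. kernel_phi H p * \<psi> p) (kernel_op H f) / G_norm \<psi> f"
  let ?sup = "SUP \<psi> \<in> Psi_class. SUP f \<in> {f \<in> G_space \<psi>. \<not> (AE x in pos_leb. f x = 0)}. ?ratio \<psi> f"
  show "?sup \<le> 1"
  proof (intro SUP_least)
    fix \<psi> f assume "\<psi> \<in> Psi_class" "f \<in> {f \<in> G_space \<psi>. \<not> (AE x in pos_leb. f x = 0)}"
    then have "?ratio \<psi> f \<le> G_norm \<psi> f / G_norm \<psi> f"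
      using bound by (intro divide_right_mono_ennreal) blast
    also have "\<dots> \<le> 1"
      \<comment> \<open>In \<open>ennreal\<close> both \<open>0 / 0\<close> and
        \<open>top / top\<close> are 0.\<close>
      by (cases "G_norm \<psi> f = 0 \<or> G_norm \<psi> f = top") (auto simp: less_top)
    finally show "?ratio \<psi> f \<le> 1" .
  qed
  have sup_ge: "ennreal (s ^ 2) \<le> ?sup" if s: "0 < s" "s < 1" for s
  proof -
    obtain n where n: "n \<ge> 1" "ennreal (s ^ 2) \<le> ?ratio (log_cutoff_weight n) (log_cutoff n)"
      using kernel_op_log_cutoff_ratio[OF assms(1) nonneg assms(3) pos s] by auto
    have "?ratio (log_cutoff_weight n) (log_cutoff n) \<le> ?sup"
      using n log_cutoff_weight_Psi_class[of n] log_cutoff_G_space[of n] log_cutoff_nonzero[of n]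
      by (intro SUP_upper2[of "log_cutoff_weight n"] SUP_upper) auto
    with n show ?thesis by (blast intro: order_trans)
  qed
  \<comment> \<open>The supremum need not be attained, so the bound by 1 is reached by letting
    \<open>s\<close> tend to 1 from below.\<close>
  have "((\<lambda>s. ennreal (s ^ 2)) \<longlongrightarrow> ennreal (1 ^ 2)) (at_left (1::real))"
    by (intro tendsto_intros)
  moreover have "eventually (\<lambda>s. ennreal (s ^ 2) \<le> ?sup) (at_left (1::real))"
    unfolding eventually_at_left_field by (intro exI[of _ 0]) (use sup_ge in auto)
  ultimately have "ennreal (1 ^ 2) \<le> ?sup"
    by (rule tendsto_upperbound) simp
  then show "1 \<le> ?sup" by simp
qed

end
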